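(* Let $\mathbf{a},\mathbf{b}\in\mathbb{R}^3$ and consider the Schrödinger equation $$ i\,\frac{dU}{dt}=H\,U,\qquad U(0)=I,\qquad H=\mathbf{a}\cdot\boldsymbol{\sigma}+\mathbf{b}\cdot\boldsymbol{\sigma}, $$ for a $2\times 2$ complex matrix $U(t)$, and set $A=-i\,\mathbf{a}\cdot\boldsymbol{\sigma}$, $B=-i\,\mathbf{b}\cdot\boldsymbol{\sigma}$. Let $s\ge 1$ and let $a_1,\dots,a_s,\,b_1,\dots,b_{s+1}\in\mathbb{C}$ be the coefficients of a splitting method of order $r\ge 1$ which is symmetric-conjugate, i.e. $a_{s+1-j}=\overline{a_j}$ for $1\le j\le s$ and $b_{s+2-j}=\overline{b_j}$ for $1\le j\le s+1$. For a time step $h>0$, let $$ U_{\mathrm{app}}(h)=e^{b_{s+1}hB}\,e^{a_s hA}\,e^{b_s hB}\cdots e^{a_1 hA}\,e^{b_1 hB} $$ be the matrix approximating the solution after one time step. Then there exists $h^*>0$ (depending on the method and on $\mathbf{a},\mathbf{b}$) such that for all $0<h<h^*$: (a) the eigenvalues of $U_{\mathrm{app}}(h)$ lie on the unit circle in the complex plane; (b) $U_{\mathrm{app}}(h)$ is conjugate to a unitary matrix, i.e. there exists an invertible matrix $P_h\in\mathbb{C}^{2\times 2}$ such that $P_h\,U_{\mathrm{app}}(h)\,P_h^{-1}$ is unitary.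
   Context: The Pauli matrices are $$\sigma_1=\begin{pmatrix}0&1\\1&0\end{pmatrix},\qquad \sigma_2=\begin{pmatrix}0&-i\\ i&0\end{pmatrix},\qquad \sigma_3=\begin{pmatrix}1&0\\0&-1\end{pmatrix},$$ and for $\mathbf{v}=(v_1,v_2,v_3)$ one writes $\mathbf{v}\cdot\boldsymbol{\sigma}=v_1\sigma_1+v_2\sigma_2+v_3\sigma_3$. The equation is equivalent to $dU/dt=(A+B)U$. A splitting method with coefficients $a_j,b_j$ for a linear problem $du/dt=Au+Bu$ is the composition $\Psi(h)=e^{b_{s+1}hB}e^{a_s hA}e^{b_s hB}\cdots e^{a_1hA}e^{b_1hB}$. It is of order $r\ge 1$ if its coefficients satisfy the polynomial order conditions ensuring $e^{h(A+B)}-\Psi(h)=\mathcal{O}(h^{r+1})$ as $h\to0$ for arbitrary square matrices $A,B$ of the same size; in particular, order $r\ge1$ entails $\sum_{j=1}^{s}a_j=1$ and $\sum_{j=1}^{s+1}b_j=1$. The bar denotes complex conjugation. *)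

theory Defs
  imports
    "Jordan_Normal_Form.Schur_Decomposition"
    "HOL-Library.Landau_Symbols"
begin

definition pauli1 :: "complex mat" where
  "pauli1 = mat_of_rows_list 2 [[0, 1], [1, 0]]"

definition pauli2 :: "complex mat" where
  "pauli2 = mat_of_rows_list 2 [[0, - \<i>], [\<i>, 0]]"

definition pauli3 :: "complex mat" where
  "pauli3 = mat_of_rows_list 2 [[1, 0], [0, - 1]]"

text \<open>Vectors are indexed from 0, so the components $v_1, v_2, v_3$ are
  \<open>v $ 0\<close>, \<open>v $ 1\<close>, \<open>v $ 2\<close>.\<close>

definition pauli_dot :: "real vec \<Rightarrow> complex mat" where
  "pauli_dot v =
     complex_of_real (v $ 0) \<cdot>\<^sub>m pauli1
   + complex_of_real (v $ 1) \<cdot>\<^sub>m pauli2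
   + complex_of_real (v $ 2) \<cdot>\<^sub>m pauli3"

text \<open>The exponential series is summed entrywise, since the type of matrices of all
  dimensions carries no topology. For square matrices every entry converges absolutely.\<close>

definition mat_exp :: "complex mat \<Rightarrow> complex mat" where
  "mat_exp M = mat (dim_row M) (dim_col M)
     (\<lambda>(i, j). \<Sum>k. (M ^\<^sub>m k) $$ (i, j) / fact k)"

definition unitary_mat :: "complex mat \<Rightarrow> bool" where
  "unitary_mat M \<longleftrightarrow> square_mat M \<and>
     mat_adjoint M * M = 1\<^sub>m (dim_row M) \<and> M * mat_adjoint M = 1\<^sub>m (dim_row M)"

text \<open>Coefficients of splitting methods are indexed from 1: only \<open>\<alpha> 1, \<dots>, \<alpha> s\<close> and
  \<open>\<beta> 1, \<dots>, \<beta> (s + 1)\<close> are used, with \<open>\<alpha>\<close> in the exponents of \<open>A\<close> and \<open>\<beta>\<close> in those of \<open>B\<close>.\<close>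

primrec splitting_step ::
  "nat \<Rightarrow> (nat \<Rightarrow> complex) \<Rightarrow> (nat \<Rightarrow> complex) \<Rightarrow> complex mat \<Rightarrow> complex mat \<Rightarrow> real \<Rightarrow> complex mat"
where
  "splitting_step 0 \<alpha> \<beta> A B h = mat_exp ((\<beta> 1 * complex_of_real h) \<cdot>\<^sub>m B)"
| "splitting_step (Suc s) \<alpha> \<beta> A B h =
     mat_exp ((\<beta> (s + 2) * complex_of_real h) \<cdot>\<^sub>m B)
   * (mat_exp ((\<alpha> (s + 1) * complex_of_real h) \<cdot>\<^sub>m A) * splitting_step s \<alpha> \<beta> A B h)"

text \<open>The error bound is required for matrices of every size. Entrywise bounds are
  equivalent to a bound in any matrix norm.\<close>

definition splitting_has_order ::
  "nat \<Rightarrow> (nat \<Rightarrow> complex) \<Rightarrow> (nat \<Rightarrow> complex) \<Rightarrow> nat \<Rightarrow> bool" where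
  "splitting_has_order s \<alpha> \<beta> r \<longleftrightarrow>
     (\<forall>n. \<forall>A \<in> carrier_mat n n. \<forall>B \<in> carrier_mat n n. \<forall>i < n. \<forall>j < n.
        (\<lambda>h. (mat_exp (complex_of_real h \<cdot>\<^sub>m (A + B)) - splitting_step s \<alpha> \<beta> A B h) $$ (i, j))
          \<in> O[at 0](\<lambda>h. complex_of_real h ^ (r + 1)))"

definition symmetric_conjugate ::
  "nat \<Rightarrow> (nat \<Rightarrow> complex) \<Rightarrow> (nat \<Rightarrow> complex) \<Rightarrow> bool" where
  "symmetric_conjugate s \<alpha> \<beta> \<longleftrightarrow>
     (\<forall>j \<in> {1..s}. \<alpha> (s + 1 - j) = cnj (\<alpha> j)) \<and>
     (\<forall>j \<in> {1..s + 1}. \<beta> (s + 2 - j) = cnj (\<beta> j))"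

end

theory Submission
  imports Defs
begin

text \<open>Choose \<open>n \<noteq> 0\<close> orthogonal to \<open>a\<close> and \<open>b\<close>. Then \<open>N = n\<cdot>\<sigma>\<close> anticommutes with \<open>A\<close> and \<open>B\<close>,
  so \<open>N U(h) = U(-h) N\<close>, while symmetric conjugacy says that \<open>U(-h)\<close> is the adjoint of \<open>U(h)\<close>.
  Since \<open>N\<^sup>2\<close> is a nonzero scalar, the trace of \<open>U(h)\<close> is real. Moreover \<open>det U(h) = 1\<close>, and
  \<open>U(h) = 1 + h (A + B) + O(h\<^sup>2)\<close> gives \<open>4 - (tr U(h))\<^sup>2 = 4 h\<^sup>2 |a + b|\<^sup>2 + O(h\<^sup>3)\<close>. If
  \<open>a + b \<noteq> 0\<close>, then for small \<open>h\<close> the trace lies strictly between \<open>-2\<close> and \<open>2\<close>, and the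
  eigenvalues of \<open>U(h)\<close> are two distinct conjugate numbers of modulus 1. If \<open>a + b = 0\<close>, all
  factors commute and consistency of the method gives \<open>U(h) = 1\<close>.\<close>

section \<open>Two-by-two matrices given by their entries\<close>

definition mat2 :: "'a \<Rightarrow> 'a \<Rightarrow> 'a \<Rightarrow> 'a \<Rightarrow> 'a mat" where
  "mat2 p q r s = mat 2 2 (\<lambda>(i, j). if i = 0 then if j = 0 then p else q else if j = 0 then r else s)"

lemma mat2_carrier [simp]: "mat2 p q r s \<in> carrier_mat 2 2"
  and mat2_dim [simp]: "dim_row (mat2 p q r s) = 2" "dim_col (mat2 p q r s) = 2"
  by (auto simp: mat2_def)

lemma mat2_index [simp]:
  "mat2 p q r s $$ (0, 0) = p" "mat2 p q r s $$ (0, Suc 0) = q"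
  "mat2 p q r s $$ (Suc 0, 0) = r" "mat2 p q r s $$ (Suc 0, Suc 0) = s"
  by (auto simp: mat2_def)

lemma mat2_exhaust:
  assumes "M \<in> carrier_mat 2 2"
  obtains p q r s where "M = mat2 p q r s"
proof -
  have "M = mat2 (M $$ (0, 0)) (M $$ (0, 1)) (M $$ (1, 0)) (M $$ (1, 1))"
    using assms by (intro eq_matI) (auto simp: less_2_cases_iff)
  then show ?thesis using that by blast
qed

lemma mat2_eq_iff [simp]:
  "mat2 p q r s = mat2 p' q' r' s' \<longleftrightarrow> p = p' \<and> q = q' \<and> r = r' \<and> s = s'"
  by (metis mat2_index)

lemma mat2_add [simp]: "mat2 p q r s + mat2 p' q' r' s' = mat2 (p + p') (q + q') (r + r') (s + s')"
  by (rule eq_matI) (auto simp: less_2_cases_iff)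

lemma mat2_smult [simp]: "c \<cdot>\<^sub>m mat2 p q r s = mat2 (c * p) (c * q) (c * r) (c * s)"
  by (rule eq_matI) (auto simp: less_2_cases_iff)

lemma mat2_mult [simp]:
  "mat2 p q r s * mat2 p' q' r' s' =
     mat2 (p * p' + q * r') (p * q' + q * s') (r * p' + s * r') (r * q' + s * s')"
  by (rule eq_matI) (auto simp: less_2_cases_iff scalar_prod_def numeral_2_eq_2 less_Suc_eq)

lemma mat2_one: "1\<^sub>m 2 = mat2 1 0 0 1"
  by (rule eq_matI) (auto simp: less_2_cases_iff)

lemma mat2_adjoint [simp]:
  "mat_adjoint (mat2 p q r s) = mat2 (conjugate p) (conjugate r) (conjugate q) (conjugate s)"
  by (rule eq_matI) (auto simp: less_2_cases_iff mat_adjoint_def mat_of_rows_def)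

lemma mat_adjoint_mult_2:
  fixes M K :: "complex mat"
  assumes "M \<in> carrier_mat 2 2" "K \<in> carrier_mat 2 2"
  shows "mat_adjoint (M * K) = mat_adjoint K * mat_adjoint M"
  using assms by (elim mat2_exhaust) (simp add: mult.commute)

lemma det_mat2: "det (mat2 p q r s) = p * s - q * r" for p :: "'a :: comm_ring_1"
proof -
  have 1: "det (mat_delete (mat2 p q r s) (Suc 0) 0) = q" "det (mat_delete (mat2 p q r s) 0 0) = s"
    by (subst det_single; simp add: mat_delete_def mat2_def)+
  show ?thesis
    using laplace_expansion_column[OF mat2_carrier, of 0 p q r s] 1
    by (simp add: cofactor_def numeral_2_eq_2 algebra_simps)
qed

section \<open>Real combinations of Pauli matrices and their exponentials in closed form\<close>

lemma pauli_dot_mat2: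
  "pauli_dot v = mat2 (v $ 2) (v $ 0 - \<i> * v $ 1) (v $ 0 + \<i> * v $ 1) (- v $ 2)"
proof -
  have *: "pauli1 = mat2 0 1 1 0" "pauli2 = mat2 0 (- \<i>) \<i> 0" "pauli3 = mat2 1 0 0 (- 1)"
    by (auto simp: pauli1_def pauli2_def pauli3_def mat2_def mat_of_rows_list_def
        intro!: eq_matI simp: less_2_cases_iff numeral_2_eq_2)
  show ?thesis unfolding pauli_dot_def * by (simp add: mult.commute)
qed

definition norm3 :: "real vec \<Rightarrow> real" where
  "norm3 v = sqrt ((v $ 0)\<^sup>2 + (v $ 1)\<^sup>2 + (v $ 2)\<^sup>2)"

lemma norm3_sq: "(norm3 v)\<^sup>2 = (v $ 0)\<^sup>2 + (v $ 1)\<^sup>2 + (v $ 2)\<^sup>2"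
  by (simp add: norm3_def)

lemma of_real_norm3_sq:
  "(complex_of_real (norm3 v))\<^sup>2 = (of_real (v $ 0))\<^sup>2 + (of_real (v $ 1))\<^sup>2 + (of_real (v $ 2))\<^sup>2"
  by (metis norm3_sq of_real_add of_real_power)

lemma norm3_eq_0_iff: "norm3 v = 0 \<longleftrightarrow> v $ 0 = 0 \<and> v $ 1 = 0 \<and> v $ 2 = 0"
  by (simp add: norm3_def add_nonneg_eq_0_iff)

text \<open>The square of \<open>M\<close> is a scalar, so even powers are scalars and odd powers
  are multiples of \<open>M\<close>. For \<open>w = 0\<close> division by zero makes every odd
  coefficient \<open>0\<close>; this is right for \<open>k = 1\<close> only because
  \<open>w0\<close> forces \<open>M = 0\<close>, which rules out nilpotent matrices.\<close>

lemma pow_mat_2_scalar_square: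
  fixes w :: complex
  assumes M: "M \<in> carrier_mat 2 2" and sq: "M * M = (- (w\<^sup>2)) \<cdot>\<^sub>m 1\<^sub>m 2" and w0: "w = 0 \<Longrightarrow> M = 0\<^sub>m 2 2"
  shows "M ^\<^sub>m k = (if even k then ((-1) ^ (k div 2) * w ^ k) \<cdot>\<^sub>m 1\<^sub>m 2
                          else ((-1) ^ (k div 2) * w ^ k / w) \<cdot>\<^sub>m M)"
proof (induction k)
  case 0
  then show ?case using M by auto
next
  case (Suc k)
  obtain p q r s where Mp: "M = mat2 p q r s" using M by (rule mat2_exhaust)
  show ?case
  proof (cases "w = 0")
    case True
    then show ?thesis using Suc w0 M by (cases k) auto
  next
    case False
    show ?thesis
    proof (cases "even k")
      case True
      then show ?thesis using Suc False by (simp add: Mp mat2_one)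
    next
      case odd: False
      define c where "c = (-1) ^ (k div 2) * w ^ k / w"
      have "M ^\<^sub>m Suc k = c \<cdot>\<^sub>m (M * M)"
        using Suc odd by (simp add: c_def [symmetric]) (simp add: Mp algebra_simps)
      also have "\<dots> = (- (c * w\<^sup>2)) \<cdot>\<^sub>m 1\<^sub>m 2"
        unfolding sq by (simp add: mat2_one)
      finally show ?thesis using odd False by (simp add: c_def power2_eq_square mult_ac)
    qed
  qed
qed

text \<open>By the closed form of the powers, the even terms of the exponential series make up the
  cosine series and the odd terms the sine series.\<close>

lemma mat_exp_scalar_square:
  assumes M: "M \<in> carrier_mat 2 2" and sq: "M * M = (- (w\<^sup>2)) \<cdot>\<^sub>m 1\<^sub>m 2" and w0: "w = 0 \<Longrightarrow> M = 0\<^sub>m 2 2"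
  shows "mat_exp M = cos w \<cdot>\<^sub>m 1\<^sub>m 2 + (sin w / w) \<cdot>\<^sub>m M"
proof (rule eq_matI)
  fix i j assume "i < dim_row (cos w \<cdot>\<^sub>m 1\<^sub>m 2 + (sin w / w) \<cdot>\<^sub>m M)"
    "j < dim_col (cos w \<cdot>\<^sub>m 1\<^sub>m 2 + (sin w / w) \<cdot>\<^sub>m M)"
  then have ij: "i < 2" "j < 2" using M by auto
  have pow: "M ^\<^sub>m k = (if even k then ((-1) ^ (k div 2) * w ^ k) \<cdot>\<^sub>m 1\<^sub>m 2
      else ((-1) ^ (k div 2) * w ^ k / w) \<cdot>\<^sub>m M)" for k
    by (rule pow_mat_2_scalar_square [OF M sq]) (rule w0)
  have "(\<lambda>k. (cos_coeff k *\<^sub>R w ^ k) * (1\<^sub>m 2 $$ (i, j)) + (sin_coeff k *\<^sub>R w ^ k) * (M $$ (i, j) / w)) sums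
        (cos w * (1\<^sub>m 2 $$ (i, j)) + sin w * (M $$ (i, j) / w))"
    by (intro sums_add sums_mult2 cos_converges sin_converges)
  also have "(\<lambda>k. (cos_coeff k *\<^sub>R w ^ k) * (1\<^sub>m 2 $$ (i, j)) + (sin_coeff k *\<^sub>R w ^ k) * (M $$ (i, j) / w))
     = (\<lambda>k. (M ^\<^sub>m k) $$ (i, j) / fact k)"
    using ij M unfolding pow
    by (intro ext) (auto simp: scaleR_conv_of_real cos_coeff_def sin_coeff_def elim!: oddE)
  finally show "mat_exp M $$ (i, j) = (cos w \<cdot>\<^sub>m 1\<^sub>m 2 + (sin w / w) \<cdot>\<^sub>m M) $$ (i, j)"
    using ij M by (auto simp: mat_exp_def sums_iff)
qed (use M in \<open>auto simp: mat_exp_def\<close>)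

text \<open>The quotient \<open>sin (z * norm3 v) / norm3 v\<close> is \<open>0\<close> for \<open>v = 0\<close>; there it is multiplied
  by \<open>0\<close> anyway.\<close>

definition pauli_exp :: "real vec \<Rightarrow> complex \<Rightarrow> complex mat" where
  "pauli_exp v z = cos (z * norm3 v) \<cdot>\<^sub>m 1\<^sub>m 2 + (- \<i> * (sin (z * norm3 v) / norm3 v)) \<cdot>\<^sub>m pauli_dot v"

text \<open>For real \<open>v\<close> the square of \<open>pauli_dot v\<close> is the scalar
  \<open>(norm3 v)\<^sup>2\<close>, so the exponent squares to
  \<open>- (z * norm3 v)\<^sup>2\<close> times the identity.\<close>

lemma mat_exp_pauli: "mat_exp (z \<cdot>\<^sub>m ((- \<i>) \<cdot>\<^sub>m pauli_dot v)) = pauli_exp v z"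
proof -
  define M where "M = z \<cdot>\<^sub>m ((- \<i>) \<cdot>\<^sub>m pauli_dot v)"
  define w where "w = z * norm3 v"
  have "M * M = (- (z\<^sup>2 * (of_real (norm3 v))\<^sup>2)) \<cdot>\<^sub>m 1\<^sub>m 2"
    unfolding of_real_norm3_sq
    by (simp add: M_def pauli_dot_mat2 mat2_one) (auto simp: power2_eq_square algebra_simps)
  then have sq: "M * M = (- (w\<^sup>2)) \<cdot>\<^sub>m 1\<^sub>m 2"
    by (simp add: w_def power_mult_distrib)
  have w0: "M = 0\<^sub>m 2 2" if "w = 0"
    using that by (auto simp: w_def M_def norm3_eq_0_iff pauli_dot_mat2 less_2_cases_iff intro!: eq_matI)
  have "mat_exp M = cos w \<cdot>\<^sub>m 1\<^sub>m 2 + (sin w / w) \<cdot>\<^sub>m M"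
    by (rule mat_exp_scalar_square[OF _ sq w0]) (auto simp: M_def pauli_dot_mat2)
  \<comment> \<open>The factor \<open>z\<close> of \<open>M\<close> cancels against the one in
    \<open>sin w / w\<close> only if \<open>z \<noteq> 0\<close>; for \<open>z = 0\<close> both
    sides are the identity.\<close>
  then show ?thesis
    by (cases "z = 0") (auto simp: M_def w_def pauli_exp_def pauli_dot_mat2 mat2_one)
qed

section \<open>Difference quotients at zero\<close>

lemma bigo_at_0_quotient_tendsto_0:
  fixes f :: "real \<Rightarrow> complex"
  assumes "f \<in> O[at 0](\<lambda>h. complex_of_real h ^ (r + 1))" and "r \<ge> 1"
  shows "((\<lambda>h. f h / h) \<longlongrightarrow> 0) (at 0)"
proof -
  obtain C where C: "eventually (\<lambda>h. norm (f h) \<le> C * norm (complex_of_real h ^ (r + 1))) (at 0)"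
    using assms(1) by (auto elim: landau_o.bigE)
  have 1: "eventually (\<lambda>h. norm (f h / h) \<le> C * \<bar>h\<bar> ^ r) (at 0)"
    using C eventually_neq_at_within [of 0]
    by eventually_elim (simp add: norm_divide norm_power norm_mult field_simps)
  have 2: "((\<lambda>h :: real. C * \<bar>h\<bar> ^ r) \<longlongrightarrow> 0) (at 0)"
    using assms(2) by (auto intro!: tendsto_eq_intros)
  have "((\<lambda>h. norm (f h / h)) \<longlongrightarrow> 0) (at 0)"
    by (rule tendsto_sandwich [OF _ 1 tendsto_const 2]) simp
  then show ?thesis by (rule tendsto_norm_zero_cancel)
qed

text \<open>Composing with the embedding of the reals turns a complex derivative into a limit over
  real step sizes, so limits in \<open>h\<close> can be found by the differentiation rules.\<close>

lemma of_real_difference_quotient_tendsto: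
  fixes F :: "complex \<Rightarrow> complex"
  assumes "(F has_field_derivative D) (at 0)"
  shows "((\<lambda>h :: real. (F (of_real h) - F 0) / of_real h) \<longlongrightarrow> D) (at 0)"
proof -
  have "((\<lambda>z. (F z - F 0) / z) \<longlongrightarrow> D) (at 0)"
    using assms by (simp add: DERIV_def)
  moreover have "filterlim complex_of_real (at 0) (at 0)"
    by (auto simp: filterlim_at eventually_at_filter intro!: tendsto_eq_intros)
  ultimately show ?thesis by (rule filterlim_compose)
qed

section \<open>Algebra of Pauli exponentials\<close>

lemma pauli_exp_carrier [simp]: "pauli_exp v z \<in> carrier_mat 2 2"
  by (simp add: pauli_exp_def pauli_dot_mat2 mat2_one)

lemma pauli_exp_mat2:
  fixes z :: complex
  shows "pauli_exp v z = mat2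
     (cos (z * norm3 v) - \<i> * (sin (z * norm3 v) / norm3 v) * v $ 2)
     (- \<i> * (sin (z * norm3 v) / norm3 v) * (v $ 0 - \<i> * v $ 1))
     (- \<i> * (sin (z * norm3 v) / norm3 v) * (v $ 0 + \<i> * v $ 1))
     (cos (z * norm3 v) + \<i> * (sin (z * norm3 v) / norm3 v) * v $ 2)"
  by (simp add: pauli_exp_def pauli_dot_mat2 mat2_one)

text \<open>The case \<open>norm3 v = 0\<close> is included, because then the sine vanishes as
  well.\<close>

lemma norm3_mult_quotient_sin:
  fixes z :: complex
  shows "of_real (norm3 v) * (sin (z * norm3 v) / norm3 v) = sin (z * norm3 v)"
  by simp

text \<open>The determinant works out to the sum of the squares of cosine and sine at
  \<open>z * norm3 v\<close>.\<close>

lemma det_pauli_exp: "det (pauli_exp v z) = 1"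
proof -
  define S where "S = sin (z * norm3 v) / norm3 v"
  define C where "C = cos (z * norm3 v)"
  have "C\<^sup>2 + (of_real (norm3 v) * S)\<^sup>2 = 1"
    by (simp add: C_def S_def norm3_mult_quotient_sin)
  then have "C\<^sup>2 + ((of_real (v $ 0))\<^sup>2 + (of_real (v $ 1))\<^sup>2 + (of_real (v $ 2))\<^sup>2) * S\<^sup>2 = 1"
    by (simp add: power_mult_distrib of_real_norm3_sq)
  then show ?thesis
    unfolding pauli_exp_mat2 det_mat2 S_def [symmetric] C_def [symmetric]
    by (simp add: power2_eq_square algebra_simps)
qed

lemma cnj_cos: "cnj (cos z) = cos (cnj z)"
  using cos_converges [of z] cos_converges [of "cnj z"]
  by (subst (asm) sums_cnj [symmetric]) (simp add: sums_iff)

lemma cnj_sin: "cnj (sin z) = sin (cnj z)"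
  using sin_converges [of z] sin_converges [of "cnj z"]
  by (subst (asm) sums_cnj [symmetric]) (simp add: sums_iff)

text \<open>\<open>pauli_dot v\<close> is Hermitian, so taking adjoints only conjugates the scalar
  \<open>- \<i> * z\<close> in the exponent.\<close>

lemma adjoint_pauli_exp: "mat_adjoint (pauli_exp v z) = pauli_exp v (- cnj z)"
proof -
  have "cnj (z * norm3 v) = cnj z * norm3 v" by simp
  then show ?thesis
    by (simp add: pauli_exp_mat2 cnj_cos cnj_sin)
qed

text \<open>The exponents commute; in closed form this amounts to the addition theorems of sine and
  cosine together with the square of \<open>pauli_dot v\<close> being a scalar.\<close>

lemma pauli_exp_add: "pauli_exp v y * pauli_exp v z = pauli_exp v (y + z)"
proof -
  define S1 where "S1 = sin (y * norm3 v) / norm3 v"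
  define S2 where "S2 = sin (z * norm3 v) / norm3 v"
  define C1 where "C1 = cos (y * norm3 v)"
  define C2 where "C2 = cos (z * norm3 v)"
  define V where "V = ((of_real (v $ 0))\<^sup>2 + (of_real (v $ 1))\<^sup>2 + (of_real (v $ 2))\<^sup>2 :: complex)"
  have "cos ((y + z) * norm3 v) = C1 * C2 - (of_real (norm3 v) * S1) * (of_real (norm3 v) * S2)"
    by (simp add: S1_def S2_def C1_def C2_def norm3_mult_quotient_sin cos_add distrib_right)
  also have "\<dots> = C1 * C2 - V * S1 * S2"
    using of_real_norm3_sq [of v] unfolding V_def [symmetric]
    by (metis (no_types, lifting) mult.assoc mult.left_commute power2_eq_square)
  finally have c: "cos ((y + z) * norm3 v) = C1 * C2 - V * S1 * S2" .
  have s: "sin ((y + z) * norm3 v) / norm3 v = S1 * C2 + C1 * S2"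
    by (simp add: S1_def S2_def C1_def C2_def sin_add distrib_right add_divide_distrib)
  show ?thesis
    unfolding pauli_exp_mat2 [of v "y + z"] c s
    unfolding pauli_exp_mat2 S1_def [symmetric] S2_def [symmetric] C1_def [symmetric] C2_def [symmetric]
    by (simp add: V_def power2_eq_square algebra_simps)
qed

lemma pauli_exp_0 [simp]: "pauli_exp v 0 = 1\<^sub>m 2"
  by (simp add: pauli_exp_mat2 mat2_one)

lemma pauli_exp_uminus_vec:
  assumes "w $ 0 = - v $ 0" "w $ 1 = - v $ 1" "w $ 2 = - v $ 2"
  shows "pauli_exp w z = pauli_exp v (- z)"
proof -
  have "norm3 w = norm3 v" using assms by (simp add: norm3_def)
  with assms show ?thesis
    by (simp add: pauli_exp_mat2) (simp add: divide_inverse algebra_simps)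
qed

lemma pauli_exp_zero_vec: "norm3 v = 0 \<Longrightarrow> pauli_exp v z = 1\<^sub>m 2"
  by (simp add: pauli_exp_mat2 mat2_one)

text \<open>Orthogonality makes \<open>pauli_dot n\<close> and \<open>pauli_dot v\<close>
  anticommute, so moving \<open>pauli_dot n\<close> across keeps the cosine term and flips the sign
  of the sine term.\<close>

lemma pauli_exp_anticommute:
  assumes "n $ 0 * v $ 0 + n $ 1 * v $ 1 + n $ 2 * v $ 2 = 0"
  shows "pauli_dot n * pauli_exp v z = pauli_exp v (- z) * pauli_dot n"
proof -
  define S where "S = sin (z * norm3 v) / norm3 v"
  have *: "complex_of_real (n $ 2) * v $ 2 = - (n $ 0 * v $ 0 + n $ 1 * v $ 1)"
    using assms by (metis add.commute eq_neg_iff_add_eq_0 of_real_mult)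
  \<comment> \<open>Variants of the orthogonality relation that also rewrite inside longer
    products.\<close>
  have **: "n $ 2 * (v $ 2 * x) = - (n $ 0 * v $ 0 + n $ 1 * v $ 1) * x"
    "v $ 2 * (n $ 2 * x) = - (n $ 0 * v $ 0 + n $ 1 * v $ 1) * x" for x :: complex
    using * by (metis mult.assoc mult.commute)+
  show ?thesis
    unfolding pauli_dot_mat2 pauli_exp_mat2
    by (simp add: S_def [symmetric]) (simp add: algebra_simps * **)
qed

text \<open>If the cross product vanishes, then every vector orthogonal to a nonzero one of
  \<open>a\<close>, \<open>b\<close> is orthogonal to both.\<close>

lemma ex_orthogonal_to_two:
  fixes a b :: "real vec"
  obtains n :: "real vec" where "norm3 n \<noteq> 0"
    "n $ 0 * a $ 0 + n $ 1 * a $ 1 + n $ 2 * a $ 2 = 0"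
    "n $ 0 * b $ 0 + n $ 1 * b $ 1 + n $ 2 * b $ 2 = 0"
proof -
  note choose = that
  define c0 where "c0 = a $ 1 * b $ 2 - a $ 2 * b $ 1"
  define c1 where "c1 = a $ 2 * b $ 0 - a $ 0 * b $ 2"
  define c2 where "c2 = a $ 0 * b $ 1 - a $ 1 * b $ 0"
  have *: thesis if "x \<noteq> 0 \<or> y \<noteq> 0 \<or> z \<noteq> 0"
    "x * a $ 0 + y * a $ 1 + z * a $ 2 = 0" "x * b $ 0 + y * b $ 1 + z * b $ 2 = 0" for x y z
    using that choose [of "vec_of_list [x, y, z]"]
    by (auto simp: norm3_eq_0_iff numeral_2_eq_2)
  consider "c0 \<noteq> 0 \<or> c1 \<noteq> 0 \<or> c2 \<noteq> 0" | "c0 = 0" "c1 = 0" "c2 = 0" by blast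
  then show thesis
  proof cases
    case 1
    then show ?thesis by (rule *) (simp_all add: c0_def c1_def c2_def algebra_simps)
  next
    case 2
    then have 2: "a $ 1 * b $ 2 = a $ 2 * b $ 1" "a $ 2 * b $ 0 = a $ 0 * b $ 2"
      "a $ 0 * b $ 1 = a $ 1 * b $ 0" by (simp_all add: c0_def c1_def c2_def)
    \<comment> \<open>In the first four cases the vector is a projection of \<open>a\<close> or
      \<open>b\<close> to a coordinate plane, turned by a right angle; in the last case any nonzero
      vector will do.\<close>
    consider "a $ 0 \<noteq> 0 \<or> a $ 1 \<noteq> 0" | "a $ 0 \<noteq> 0 \<or> a $ 2 \<noteq> 0" | "b $ 0 \<noteq> 0 \<or> b $ 1 \<noteq> 0"
      | "b $ 0 \<noteq> 0 \<or> b $ 2 \<noteq> 0" | "a $ 0 = 0" "a $ 1 = 0" "a $ 2 = 0" "b $ 0 = 0" "b $ 1 = 0" "b $ 2 = 0"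
      by blast
    then show ?thesis
      by cases (rule * [of "- (a $ 1)" "a $ 0" 0] * [of "- (a $ 2)" 0 "a $ 0"]
        * [of "- (b $ 1)" "b $ 0" 0] * [of "- (b $ 2)" 0 "b $ 0"] * [of 1 0 0];
        use 2 in \<open>auto simp: algebra_simps\<close>; fail)+
  qed
qed

section \<open>Splitting steps for Pauli exponents\<close>

text \<open>Symmetric conjugacy relates the coefficients only within their index ranges, so equality
  of the coefficient functions cannot be expected outside them.\<close>

lemma splitting_step_cong:
  assumes "\<And>j. 1 \<le> j \<Longrightarrow> j \<le> s \<Longrightarrow> \<alpha> j = \<alpha>' j" "\<And>j. 1 \<le> j \<Longrightarrow> j \<le> s + 1 \<Longrightarrow> \<beta> j = \<beta>' j"
  shows "splitting_step s \<alpha> \<beta> A B h = splitting_step s \<alpha>' \<beta>' A B h"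
  using assms by (induction s) simp_all

context
  fixes a b :: "real vec" and A B :: "complex mat"
  assumes A: "A = (- \<i>) \<cdot>\<^sub>m pauli_dot a" and B: "B = (- \<i>) \<cdot>\<^sub>m pauli_dot b"
begin

text \<open>These equations take the place of the defining ones below, so that only
  \<open>pauli_exp\<close> remains to be dealt with.\<close>

lemma splitting_step_pauli:
  "splitting_step 0 \<alpha> \<beta> A B h = pauli_exp b (\<beta> 1 * h)"
  "splitting_step (Suc s) \<alpha> \<beta> A B h =
     pauli_exp b (\<beta> (s + 2) * h) * (pauli_exp a (\<alpha> (s + 1) * h) * splitting_step s \<alpha> \<beta> A B h)"
  by (simp_all only: splitting_step.simps A B mat_exp_pauli)

lemma splitting_step_carrier: "splitting_step s \<alpha> \<beta> A B h \<in> carrier_mat 2 2"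
  by (induction s) (simp_all add: splitting_step_pauli mult_carrier_mat [of _ 2 2] del: splitting_step.simps)

lemma det_splitting_step: "det (splitting_step s \<alpha> \<beta> A B h) = 1"
proof (induction s)
  case (Suc s)
  then show ?case
    unfolding splitting_step_pauli
    by (subst det_mult [of _ 2] | simp add: det_pauli_exp splitting_step_carrier mult_carrier_mat [of _ 2 2])+
qed (simp add: splitting_step_pauli det_pauli_exp del: splitting_step.simps)

text \<open>The recursion adds factors on the left, whereas adjoints reverse products; this is the
  matching recursion on the right, with the remaining coefficients shifted by one.\<close>

lemma splitting_step_peel_right:
  "splitting_step (Suc s) \<alpha> \<beta> A B h =
     splitting_step s (\<lambda>j. \<alpha> (Suc j)) (\<lambda>j. \<beta> (Suc j)) A B h *
       (pauli_exp a (\<alpha> 1 * h) * pauli_exp b (\<beta> 1 * h))"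
proof (induction s)
  case 0
  then show ?case by (simp add: splitting_step_pauli numeral_2_eq_2 del: splitting_step.simps)
next
  case (Suc s)
  have [simp]: "X * (Y * Z) = X * Y * Z"
    if "X \<in> carrier_mat 2 2" "Y \<in> carrier_mat 2 2" "Z \<in> carrier_mat 2 2" for X Y Z :: "complex mat"
    using that by (metis assoc_mult_mat)
  have [simp]: "X * Y \<in> carrier_mat 2 2"
    if "X \<in> carrier_mat 2 2" "Y \<in> carrier_mat 2 2" for X Y :: "complex mat"
    using that by simp
  show ?case
    unfolding splitting_step_pauli(2) [of "Suc s"] Suc.IH splitting_step_pauli(2) [of s "\<lambda>j. \<alpha> (Suc j)"]
    by (simp add: splitting_step_carrier)
qed

text \<open>The adjoint reverses the order of the factors, which reflects the indices, and
  conjugates the coefficients. The sign change in each exponent is absorbed into the step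
  size.\<close>

lemma adjoint_splitting_step:
  "mat_adjoint (splitting_step s \<alpha> \<beta> A B h) =
     splitting_step s (\<lambda>j. cnj (\<alpha> (s + 1 - j))) (\<lambda>j. cnj (\<beta> (s + 2 - j))) A B (- h)"
proof (induction s)
  case 0
  then show ?case by (simp add: splitting_step_pauli adjoint_pauli_exp del: splitting_step.simps)
next
  case (Suc s)
  let ?U = "splitting_step s \<alpha> \<beta> A B h"
  have "mat_adjoint (splitting_step (Suc s) \<alpha> \<beta> A B h) =
    (mat_adjoint ?U * pauli_exp a (- cnj (\<alpha> (s + 1) * h))) * pauli_exp b (- cnj (\<beta> (s + 2) * h))"
    unfolding splitting_step_pauli(2)
    by (simp add: mat_adjoint_mult_2 splitting_step_carrier adjoint_pauli_exp mult_carrier_mat [of _ 2 2])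
  also have "\<dots> = mat_adjoint ?U *
     (pauli_exp a (- cnj (\<alpha> (s + 1) * h)) * pauli_exp b (- cnj (\<beta> (s + 2) * h)))"
    unfolding Suc.IH by (rule assoc_mult_mat [of _ 2 2 _ 2 _ 2]) (simp_all add: splitting_step_carrier)
  finally show ?case
    unfolding Suc.IH splitting_step_peel_right by simp
qed

text \<open>\<open>pauli_dot n\<close> is moved through the product one factor at a time, each
  factor having its exponent negated.\<close>

lemma splitting_step_anticommute:
  assumes na: "n $ 0 * a $ 0 + n $ 1 * a $ 1 + n $ 2 * a $ 2 = 0"
    and nb: "n $ 0 * b $ 0 + n $ 1 * b $ 1 + n $ 2 * b $ 2 = 0"
  shows "pauli_dot n * splitting_step s \<alpha> \<beta> A B h = splitting_step s \<alpha> \<beta> A B (- h) * pauli_dot n"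
proof (induction s)
  case 0
  then show ?case
    by (simp add: splitting_step_pauli pauli_exp_anticommute [OF nb] del: splitting_step.simps)
next
  case (Suc s)
  let ?N = "pauli_dot n" and ?Eb = "\<lambda>h :: real. pauli_exp b (\<beta> (s + 2) * h)"
    and ?Ea = "\<lambda>h :: real. pauli_exp a (\<alpha> (s + 1) * h)" and ?U = "splitting_step s \<alpha> \<beta> A B"
  have N: "?N \<in> carrier_mat 2 2" by (simp add: pauli_dot_mat2)
  have assoc: "X * Y * Z = X * (Y * Z)"
    if "X \<in> carrier_mat 2 2" "Y \<in> carrier_mat 2 2" "Z \<in> carrier_mat 2 2" for X Y Z :: "complex mat"
    using that by (metis assoc_mult_mat)
  note C = N splitting_step_carrier mult_carrier_mat [of _ 2 2]
  have "?N * (?Eb h * (?Ea h * ?U h)) = (?N * ?Eb h) * (?Ea h * ?U h)"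
    by (simp add: assoc C)
  also have "\<dots> = ?Eb (- h) * ((?N * ?Ea h) * ?U h)"
    by (simp add: pauli_exp_anticommute [OF nb] assoc C)
  also have "\<dots> = ?Eb (- h) * (?Ea (- h) * (?N * ?U h))"
    by (simp add: pauli_exp_anticommute [OF na] assoc C)
  also have "\<dots> = (?Eb (- h) * (?Ea (- h) * ?U (- h))) * ?N"
    by (simp add: Suc.IH assoc C)
  finally show ?case by (simp only: splitting_step_pauli)
qed

text \<open>Write the assumption as \<open>N * M = M' * N\<close>. The square of the traceless
  \<open>N\<close> is the scalar \<open>c * c + d * e\<close>, so multiplying by \<open>N\<close> on
  the right and taking traces gives the claim.\<close>

lemma trace_mult_eq_if_intertwined:
  fixes c :: "'a :: comm_ring_1"
  assumes "mat2 c d e (- c) * mat2 u v w x = mat2 u' v' w' x' * mat2 c d e (- c)"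
  shows "(c * c + d * e) * (u + x) = (c * c + d * e) * (u' + x')"
proof -
  have "c * u + d * w = u' * c + v' * e" "c * v + d * x = u' * d - v' * c"
    "e * u - c * w = w' * c + x' * e" "e * v - c * x = w' * d - x' * c"
    using assms by simp_all
  \<comment> \<open>Both sides are the traces of the two products after multiplication by
    \<open>N\<close> on the right.\<close>
  then have "c * (c * u + d * w) + e * (c * v + d * x) + d * (e * u - c * w) - c * (e * v - c * x) =
    c * (u' * c + v' * e) + e * (u' * d - v' * c) + d * (w' * c + x' * e) - c * (w' * d - x' * c)"
    by simp
  then show ?thesis by (simp add: algebra_simps)
qed

lemma trace_splitting_step_real:
  assumes sc: "symmetric_conjugate s \<alpha> \<beta>" and U: "splitting_step s \<alpha> \<beta> A B h = mat2 u v w x"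
  shows "u + x \<in> \<real>"
proof -
  obtain n :: "real vec" where n: "norm3 n \<noteq> 0"
    "n $ 0 * a $ 0 + n $ 1 * a $ 1 + n $ 2 * a $ 2 = 0"
    "n $ 0 * b $ 0 + n $ 1 * b $ 1 + n $ 2 * b $ 2 = 0"
    by (rule ex_orthogonal_to_two)
  \<comment> \<open>Symmetric conjugacy turns the reflected and conjugated coefficients back into
    the original ones.\<close>
  have "splitting_step s \<alpha> \<beta> A B (- h) = mat_adjoint (splitting_step s \<alpha> \<beta> A B h)"
    unfolding adjoint_splitting_step
    by (rule splitting_step_cong) (use sc in \<open>auto simp: symmetric_conjugate_def\<close>)
  then have "pauli_dot n * mat2 u v w x = mat_adjoint (mat2 u v w x) * pauli_dot n"
    using splitting_step_anticommute [OF n(2,3), of s \<alpha> \<beta> h] by (simp add: U)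
  then have "(of_real (norm3 n))\<^sup>2 * (u + x) = (of_real (norm3 n))\<^sup>2 * cnj (u + x)"
    using trace_mult_eq_if_intertwined
      [of "of_real (n $ 2)" "n $ 0 - \<i> * n $ 1" "n $ 0 + \<i> * n $ 1" u v w x "cnj u" "cnj w" "cnj v" "cnj x"]
    unfolding of_real_norm3_sq
    by (simp add: pauli_dot_mat2 del: mat2_mult) (simp add: power2_eq_square algebra_simps)
  then show ?thesis using n(1) by (simp add: complex_is_Real_iff complex_eq_iff)
qed

section \<open>Consequences of the order condition to first order in the step size\<close>

text \<open>Every factor is an exponential of a multiple of the same matrix, so the exponents add
  up, those from \<open>b\<close> with a minus sign.\<close>

lemma splitting_step_opposite:
  assumes ab: "b $ 0 = - a $ 0" "b $ 1 = - a $ 1" "b $ 2 = - a $ 2"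
  shows "splitting_step s \<alpha> \<beta> A B h = pauli_exp a ((sum \<alpha> {1..s} - sum \<beta> {1..s + 1}) * h)"
proof -
  have b: "pauli_exp b z = pauli_exp a (- z)" for z
    by (rule pauli_exp_uminus_vec) (fact ab)+
  show ?thesis
    by (induction s) (simp_all add: splitting_step_pauli b pauli_exp_add algebra_simps del: splitting_step.simps)
qed

lemma splitting_error_quotient_tendsto_0:
  assumes ord: "splitting_has_order s \<alpha> \<beta> r" and r: "r \<ge> 1" and ij: "i < 2" "j < 2"
    and dim: "dim_vec a = 3" "dim_vec b = 3"
  shows "((\<lambda>h :: real. (pauli_exp (a + b) h $$ (i, j) - splitting_step s \<alpha> \<beta> A B h $$ (i, j)) / h) \<longlongrightarrow> 0) (at 0)"
proof -
  have carr: "A \<in> carrier_mat 2 2" "B \<in> carrier_mat 2 2" by (simp_all add: A B pauli_dot_mat2)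
  have "A + B = (- \<i>) \<cdot>\<^sub>m pauli_dot (a + b)"
    using dim by (simp add: A B pauli_dot_mat2 algebra_simps)
  then have e: "mat_exp (complex_of_real h \<cdot>\<^sub>m (A + B)) = pauli_exp (a + b) h" for h :: real
    by (simp only: mat_exp_pauli)
  have "(\<lambda>h. (pauli_exp (a + b) (of_real h) - splitting_step s \<alpha> \<beta> A B h) $$ (i, j))
      \<in> O[at 0](\<lambda>h. complex_of_real h ^ (r + 1))"
    using ord carr ij unfolding splitting_has_order_def e [symmetric] by blast
  also have "(\<lambda>h. (pauli_exp (a + b) (of_real h) - splitting_step s \<alpha> \<beta> A B h) $$ (i, j)) =
     (\<lambda>h. pauli_exp (a + b) h $$ (i, j) - splitting_step s \<alpha> \<beta> A B h $$ (i, j))"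
    using carrier_matD [OF splitting_step_carrier [of s \<alpha> \<beta>]] ij by (intro ext index_minus_mat) simp_all
  finally show ?thesis using r by (rule bigo_at_0_quotient_tendsto_0)
qed

end

text \<open>Opposite matrices of unit norm detect the difference of the two consistency sums.\<close>

lemma splitting_has_order_imp_sum_eq:
  assumes ord: "splitting_has_order s \<alpha> \<beta> r" and r: "r \<ge> 1"
  shows "sum \<alpha> {1..s} = sum \<beta> {1..s + 1}"
proof -
  \<comment> \<open>The third unit vector makes all factors diagonal, so a single entry
    suffices.\<close>
  define a :: "real vec" where "a = vec_of_list [0, 0, 1]"
  define b :: "real vec" where "b = vec_of_list [0, 0, - 1]"
  define A where "A = (- \<i>) \<cdot>\<^sub>m pauli_dot a"
  define B where "B = (- \<i>) \<cdot>\<^sub>m pauli_dot b"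
  define k where "k = sum \<alpha> {1..s} - sum \<beta> {1..s + 1}"
  have comp: "a $ 0 = 0" "a $ 1 = 0" "a $ 2 = 1" "b $ 0 = 0" "b $ 1 = 0" "b $ 2 = - 1"
    "dim_vec a = 3" "dim_vec b = 3"
    by (simp_all add: a_def b_def numeral_2_eq_2)
  have na: "norm3 a = 1" using comp by (simp add: norm3_def)
  have "norm3 (a + b) = 0" using comp by (simp add: norm3_eq_0_iff)
  moreover have "splitting_step s \<alpha> \<beta> A B h = pauli_exp a (k * h)" for h
    unfolding k_def by (rule splitting_step_opposite [OF A_def B_def]) (use comp in auto)
  ultimately have "((\<lambda>h :: real. (1\<^sub>m 2 $$ (0, 0) - pauli_exp a (k * h) $$ (0, 0)) / h) \<longlongrightarrow> 0) (at 0)"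
    using splitting_error_quotient_tendsto_0 [OF A_def B_def ord r, of 0 0] comp
    by (simp add: pauli_exp_zero_vec)
  then have "((\<lambda>h :: real. (1 - (cos (k * h) - \<i> * sin (k * h))) / h) \<longlongrightarrow> 0) (at 0)"
    using comp by (simp add: pauli_exp_mat2 na)
  \<comment> \<open>The entry is \<open>1 - exp (- \<i> * k * h)\<close>, with derivative
    \<open>\<i> * k\<close> at \<open>0\<close>; uniqueness of limits then yields
    \<open>k = 0\<close>.\<close>
  moreover have "((\<lambda>h :: real. ((1 - (cos (k * h) - \<i> * sin (k * h))) - (1 - (cos (k * 0) - \<i> * sin (k * 0)))) / h)
      \<longlongrightarrow> \<i> * k) (at 0)"
    by (rule of_real_difference_quotient_tendsto) (auto intro!: derivative_eq_intros)
  ultimately have "\<i> * k = 0"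
    by (intro tendsto_unique [of "at (0::real)"]) simp_all
  then show ?thesis by (simp add: k_def)
qed

section \<open>Eigenvalues and diagonalization of two-by-two matrices\<close>

text \<open>A real root is excluded by completing the square. For a non-real root the imaginary part
  of the equation gives \<open>t = 2 * p\<close>, and its real part then says that the modulus is
  1.\<close>

lemma cmod_eq_1_if_root:
  assumes z: "z\<^sup>2 - of_real t * z + 1 = 0" and t: "\<bar>t\<bar> < 2"
  shows "cmod z = 1"
proof -
  obtain p q where pq: "z = Complex p q" by (cases z)
  have 1: "p\<^sup>2 - q\<^sup>2 - t * p + 1 = 0" and 2: "q * (2 * p - t) = 0"
    using z by (simp_all add: pq complex_eq_iff power2_eq_square algebra_simps)
  have "q \<noteq> 0"
  proof
    assume "q = 0"
    then have "(p - t / 2)\<^sup>2 + (1 - (t / 2)\<^sup>2) = 0"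
      using 1 by (simp add: power2_eq_square field_simps)
    moreover have "(t / 2)\<^sup>2 < 1" using t by (simp add: abs_square_less_1)
    ultimately show False using zero_le_power2 [of "p - t / 2"] by linarith
  qed
  then have "t = 2 * p" using 2 by simp
  then have "p\<^sup>2 + q\<^sup>2 = 1" using 1 by (simp add: power2_eq_square)
  then show ?thesis by (simp add: pq cmod_def)
qed

text \<open>Eliminating either component from the two eigenvector equations shows that the
  characteristic polynomial at \<open>z\<close> annihilates both components, and one of them is
  nonzero.\<close>

lemma eigenvalue_mat2_root:
  assumes "eigenvalue (mat2 u v w x) z"
  shows "z\<^sup>2 - (u + x) * z + (u * x - v * w) = (0 :: complex)"
proof -
  obtain y where y: "y \<in> carrier_vec 2" "y \<noteq> 0\<^sub>v 2" "mat2 u v w x *\<^sub>v y = z \<cdot>\<^sub>v y"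
    using assms by (auto simp: eigenvalue_def eigenvector_def)
  have "(mat2 u v w x *\<^sub>v y) $ i = z * y $ i" if "i < 2" for i
    using y that by simp
  from this [of 0] this [of 1] have 1: "u * y $ 0 + v * y $ 1 = z * y $ 0" "w * y $ 0 + x * y $ 1 = z * y $ 1"
    using y(1) by (simp_all add: scalar_prod_def numeral_2_eq_2)
  have "y $ 0 \<noteq> 0 \<or> y $ 1 \<noteq> 0"
    using y(1,2) by (auto simp: less_2_cases_iff intro!: eq_vecI)
  moreover have "(z\<^sup>2 - (u + x) * z + (u * x - v * w)) * p = 0 \<and>
      (z\<^sup>2 - (u + x) * z + (u * x - v * w)) * q = 0"
    if "u * p + v * q = z * p" "w * p + x * q = z * q" for p q
  proof -
    have p: "v * q = (z - u) * p" and q: "w * p = (z - x) * q"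
      using that by (simp_all add: algebra_simps)
    have "(z\<^sup>2 - (u + x) * z + (u * x - v * w)) * p = (z - x) * ((z - u) * p) - v * (w * p)"
      by (simp add: power2_eq_square algebra_simps)
    also have "\<dots> = 0" unfolding q by (simp flip: p)
    finally have 1: "(z\<^sup>2 - (u + x) * z + (u * x - v * w)) * p = 0" .
    have "(z\<^sup>2 - (u + x) * z + (u * x - v * w)) * q = (z - u) * ((z - x) * q) - w * (v * q)"
      by (simp add: power2_eq_square algebra_simps)
    also have "\<dots> = 0" unfolding p by (simp flip: q)
    finally show ?thesis using 1 by simp
  qed
  ultimately show ?thesis using 1 by fastforce
qed

text \<open>The columns of \<open>Q\<close> are eigenvectors for \<open>l\<close> and
  \<open>m\<close>, and \<open>P\<close> is its inverse, the adjugate divided by the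
  determinant.\<close>

lemma mat2_diagonalizable:
  fixes u :: "'a :: field"
  assumes tr: "u + x = l + m" and dt: "u * x - v * w = l * m" and neq: "l \<noteq> m"
  obtains P Q where "P \<in> carrier_mat 2 2" "Q \<in> carrier_mat 2 2" "P * Q = 1\<^sub>m 2" "Q * P = 1\<^sub>m 2"
    "P * mat2 u v w x * Q = mat2 l 0 0 m"
proof -
  have x: "x = l + m - u" using tr by (simp add: algebra_simps)
  have vw: "v * w = u * x - l * m" using dt by (simp add: algebra_simps)
  have "\<exists>p q r s. p * s - q * r \<noteq> 0 \<and> mat2 u v w x * mat2 p q r s = mat2 p q r s * mat2 l 0 0 m"
  proof -
    consider "v \<noteq> 0" | "w \<noteq> 0" | "v = 0" "w = 0" "u = l" | "v = 0" "w = 0" "u \<noteq> l" by blast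
    then show ?thesis
    proof cases
      \<comment> \<open>The eigenvectors are \<open>(v, l - u)\<close> and
        \<open>(v, m - u)\<close>, independent because \<open>l \<noteq> m\<close>; in the next case
        they are \<open>(l - x, w)\<close> and \<open>(m - x, w)\<close>.\<close>
      case 1
      have "w * v + x * (l - u) = (l - u) * l" "w * v + x * (m - u) = (m - u) * m"
        unfolding mult.commute [of w v] vw x by (simp_all add: algebra_simps)
      moreover have "v * (m - u) - v * (l - u) \<noteq> 0" using 1 neq by (simp add: algebra_simps)
      ultimately show ?thesis
        by (intro exI [of _ v] exI [of _ "l - u"] exI [of _ "m - u"]) (simp add: algebra_simps)
    next
      case 2
      have "u * (l - x) + v * w = (l - x) * l" "u * (m - x) + v * w = (m - x) * m"
        unfolding vw x by (simp_all add: algebra_simps)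
      moreover have "(l - x) * w - (m - x) * w \<noteq> 0" using 2 neq by (simp add: algebra_simps)
      ultimately show ?thesis
        by (intro exI [of _ w] exI [of _ "l - x"] exI [of _ "m - x"]) (simp add: algebra_simps)
    next
      case 3
      then show ?thesis using tr
        by (intro exI [of _ 1] exI [of _ 0]) simp
    next
      case 4
      \<comment> \<open>The matrix is diagonal with \<open>m\<close> before \<open>l\<close>, so the
        permutation matrix serves as \<open>Q\<close>.\<close>
      have "(u - l) * (u - m) = 0" using vw 4(1,2) unfolding x by (simp add: algebra_simps)
      then have "u = m" using 4(3) by simp
      then show ?thesis using tr 4(1,2)
        by (intro exI [of _ 0] exI [of _ 1] conjI) auto
    qed
  qed
  then obtain p q r s where d: "p * s - q * r \<noteq> 0"
    and eq: "mat2 u v w x * mat2 p q r s = mat2 p q r s * mat2 l 0 0 m" by blast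
  define Q where "Q = mat2 p q r s"
  define P where "P = (1 / (p * s - q * r)) \<cdot>\<^sub>m mat2 s (- q) (- r) p"
  have PQ: "P * Q = 1\<^sub>m 2" "Q * P = 1\<^sub>m 2"
    using d by (auto simp: P_def Q_def mat2_one divide_simps)
  have carr: "P \<in> carrier_mat 2 2" "Q \<in> carrier_mat 2 2" by (simp_all add: P_def Q_def)
  have "P * mat2 u v w x * Q = P * (mat2 u v w x * Q)"
    by (rule assoc_mult_mat [OF carr(1) mat2_carrier carr(2)])
  also have "\<dots> = P * (Q * mat2 l 0 0 m)" using eq by (simp only: Q_def)
  also have "\<dots> = (P * Q) * mat2 l 0 0 m"
    by (rule assoc_mult_mat [OF carr(1) carr(2) mat2_carrier, symmetric])
  also have "\<dots> = mat2 l 0 0 m" using PQ by (simp add: mat2_one)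
  finally show ?thesis using that carr PQ by blast
qed

lemma unitary_conjugate_if_trace_less_2:
  assumes M: "M = mat2 u v w x" and dt: "det M = 1" and tr: "u + x = of_real t" and t: "\<bar>t\<bar> < 2"
  shows "eigenvalue M z \<Longrightarrow> cmod z = 1"
    and "\<exists>P \<in> carrier_mat 2 2. \<exists>Q \<in> carrier_mat 2 2.
       inverts_mat P Q \<and> inverts_mat Q P \<and> unitary_mat (P * M * Q)"
proof -
  have d: "u * x - v * w = 1" using dt by (simp add: M det_mat2)
  show "cmod z = 1" if "eigenvalue M z"
    using eigenvalue_mat2_root [OF that [unfolded M]] cmod_eq_1_if_root [OF _ t] by (simp add: tr d)
  have t4: "t\<^sup>2 < 4" using t abs_square_less_1 [of "t / 2"] by (simp add: power_divide)
  \<comment> \<open>The root of \<open>z\<^sup>2 - t * z + 1\<close> in the upper half-plane. The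
    other root is its conjugate, distinct from it because \<open>\<bar>t\<bar> < 2\<close>, and
    \<open>l * cnj l = 1\<close> makes the diagonal form unitary.\<close>
  define l where "l = Complex (t / 2) (sqrt (1 - t\<^sup>2 / 4))"
  have 1: "u + x = l + cnj l" by (simp add: tr l_def complex_eq_iff)
  have "l * cnj l = 1"
    using t4 by (simp add: l_def complex_eq_iff power2_eq_square [symmetric] power_divide)
  with d have dl: "u * x - v * w = l * cnj l" by simp
  have 2: "l \<noteq> cnj l" using t4 by (simp add: l_def complex_eq_iff)
  obtain P Q where PQ: "P \<in> carrier_mat 2 2" "Q \<in> carrier_mat 2 2" "P * Q = 1\<^sub>m 2" "Q * P = 1\<^sub>m 2"
    "P * M * Q = mat2 l 0 0 (cnj l)"
    by (rule mat2_diagonalizable [OF 1 dl 2, folded M])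
  have "unitary_mat (P * M * Q)"
    using d dl by (simp add: PQ unitary_mat_def mat2_one mult.commute)
  then show "\<exists>P \<in> carrier_mat 2 2. \<exists>Q \<in> carrier_mat 2 2.
       inverts_mat P Q \<and> inverts_mat Q P \<and> unitary_mat (P * M * Q)"
    using PQ by (intro bexI [of _ P] bexI [of _ Q]) (auto simp: inverts_mat_def)
qed

section \<open>The trace for small step sizes and the conclusion\<close>

text \<open>Entry by entry, the derivative of the exponential at \<open>0\<close> is its generator
  \<open>- \<i>\<close> times \<open>pauli_dot c\<close>.\<close>

lemma pauli_exp_difference_quotient:
  assumes "norm3 c \<noteq> 0"
  shows "((\<lambda>h :: real. (pauli_exp c h $$ (0, 0) - 1) / h) \<longlongrightarrow> - \<i> * c $ 2) (at 0)"
    "((\<lambda>h :: real. pauli_exp c h $$ (0, 1) / h) \<longlongrightarrow> - \<i> * (c $ 0 - \<i> * c $ 1)) (at 0)"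
    "((\<lambda>h :: real. pauli_exp c h $$ (1, 0) / h) \<longlongrightarrow> - \<i> * (c $ 0 + \<i> * c $ 1)) (at 0)"
    "((\<lambda>h :: real. (pauli_exp c h $$ (1, 1) - 1) / h) \<longlongrightarrow> \<i> * c $ 2) (at 0)"
proof -
  have *: "((\<lambda>h :: real. (cos (complex_of_real h * norm3 c) + k * (sin (complex_of_real h * norm3 c) / norm3 c) - 1) / of_real h) \<longlongrightarrow> k) (at 0)"
    (is "(?f \<longlongrightarrow> k) (at 0)") for k
  proof -
    have "((\<lambda>h :: real. ((cos (complex_of_real h * norm3 c) + k * (sin (complex_of_real h * norm3 c) / norm3 c)) -
        (cos (0 * complex_of_real (norm3 c)) + k * (sin (0 * complex_of_real (norm3 c)) / norm3 c))) / of_real h) \<longlongrightarrow> k) (at 0)"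
      by (rule of_real_difference_quotient_tendsto) (use assms in \<open>auto intro!: derivative_eq_intros\<close>)
    then show ?thesis by simp
  qed
  have **: "((\<lambda>h :: real. (k * (sin (complex_of_real h * norm3 c) / norm3 c)) / of_real h) \<longlongrightarrow> k) (at 0)" for k
  proof -
    have "((\<lambda>h :: real. (k * (sin (complex_of_real h * norm3 c) / norm3 c) - k * (sin (0 * complex_of_real (norm3 c)) / norm3 c)) / of_real h) \<longlongrightarrow> k) (at 0)"
      by (rule of_real_difference_quotient_tendsto) (use assms in \<open>auto intro!: derivative_eq_intros\<close>)
    then show ?thesis by simp
  qed
  show "((\<lambda>h :: real. (pauli_exp c h $$ (0, 0) - 1) / h) \<longlongrightarrow> - \<i> * c $ 2) (at 0)"
    using * [of "- \<i> * c $ 2"] by (simp add: pauli_exp_mat2 mult_ac)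
  show "((\<lambda>h :: real. pauli_exp c h $$ (0, 1) / h) \<longlongrightarrow> - \<i> * (c $ 0 - \<i> * c $ 1)) (at 0)"
    using ** [of "- \<i> * (c $ 0 - \<i> * c $ 1)"] by (simp add: pauli_exp_mat2 mult_ac)
  show "((\<lambda>h :: real. pauli_exp c h $$ (1, 0) / h) \<longlongrightarrow> - \<i> * (c $ 0 + \<i> * c $ 1)) (at 0)"
    using ** [of "- \<i> * (c $ 0 + \<i> * c $ 1)"] by (simp add: pauli_exp_mat2 mult_ac)
  show "((\<lambda>h :: real. (pauli_exp c h $$ (1, 1) - 1) / h) \<longlongrightarrow> \<i> * c $ 2) (at 0)"
    using * [of "\<i> * c $ 2"] by (simp add: pauli_exp_mat2 mult_ac)
qed

theorem proposition2p1:
  fixes a b :: "real vec" and A B :: "complex mat"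
    and s r :: nat and \<alpha> \<beta> :: "nat \<Rightarrow> complex"
  assumes "a \<in> carrier_vec 3" and "b \<in> carrier_vec 3"
    and "A = (- \<i>) \<cdot>\<^sub>m pauli_dot a" and "B = (- \<i>) \<cdot>\<^sub>m pauli_dot b"
    and "s \<ge> 1" and "r \<ge> 1"
    and "splitting_has_order s \<alpha> \<beta> r"
    and "symmetric_conjugate s \<alpha> \<beta>"
  shows "\<exists>h' > 0. \<forall>h :: real. 0 < h \<and> h < h' \<longrightarrow>
    (\<forall>z. eigenvalue (splitting_step s \<alpha> \<beta> A B h) z \<longrightarrow> cmod z = 1) \<and>
    (\<exists>P \<in> carrier_mat 2 2. \<exists>Q \<in> carrier_mat 2 2.
       inverts_mat P Q \<and> inverts_mat Q P \<and>
       unitary_mat (P * splitting_step s \<alpha> \<beta> A B h * Q))"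
proof -
  have A: "A = (- \<i>) \<cdot>\<^sub>m pauli_dot a" and B: "B = (- \<i>) \<cdot>\<^sub>m pauli_dot b"
    and r: "r \<ge> 1" and ord: "splitting_has_order s \<alpha> \<beta> r"
    and sc: "symmetric_conjugate s \<alpha> \<beta>" and dim: "dim_vec a = 3" "dim_vec b = 3"
    using assms by auto
  define U where "U = splitting_step s \<alpha> \<beta> A B"
  define c where "c = a + b"
  have U_carrier: "U h \<in> carrier_mat 2 2" for h
    unfolding U_def by (rule splitting_step_carrier [OF A B])
  have U_mat2: "U h = mat2 (U h $$ (0, 0)) (U h $$ (0, 1)) (U h $$ (1, 0)) (U h $$ (1, 1))" for h
    using U_carrier [of h] by (elim mat2_exhaust) simp
  have dt: "det (U h) = 1" for h
    unfolding U_def by (rule det_splitting_step [OF A B])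
  have "\<exists>h' > 0. \<forall>h :: real. 0 < h \<and> h < h' \<longrightarrow>
    (\<forall>z. eigenvalue (U h) z \<longrightarrow> cmod z = 1) \<and>
    (\<exists>P \<in> carrier_mat 2 2. \<exists>Q \<in> carrier_mat 2 2.
       inverts_mat P Q \<and> inverts_mat Q P \<and> unitary_mat (P * U h * Q))"
  proof (cases "norm3 c = 0")
    case True
    then have "b $ 0 = - a $ 0" "b $ 1 = - a $ 1" "b $ 2 = - a $ 2"
      using dim by (simp_all add: c_def norm3_eq_0_iff)
    from splitting_step_opposite [OF A B this] splitting_has_order_imp_sum_eq [OF ord r]
    have U1: "U h = 1\<^sub>m 2" for h by (simp add: U_def)
    have "cmod z = 1" if "eigenvalue (U h) z" for h z
    proof -
      have "z\<^sup>2 - (1 + 1) * z + (1 * 1 - 0 * 0) = 0"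
        using that unfolding U1 mat2_one by (rule eigenvalue_mat2_root)
      then have "(z - 1)\<^sup>2 = 0" by (simp add: power2_eq_square algebra_simps)
      then show ?thesis by simp
    qed
    moreover have "unitary_mat (1\<^sub>m 2 * U h * 1\<^sub>m 2)" for h
      by (simp add: U1 unitary_mat_def) (simp add: mat2_one)
    moreover have "inverts_mat (1\<^sub>m 2 :: complex mat) (1\<^sub>m 2)"
      by (simp add: inverts_mat_def)
    ultimately show ?thesis
      by (intro exI [of _ 1] conjI allI impI bexI [of _ "1\<^sub>m 2"]) auto
  next
    case False
    define f where "f i j h = U h $$ (i, j)" for i j h
    have err: "((\<lambda>h :: real. (pauli_exp c h $$ (i, j) - f i j h) / h) \<longlongrightarrow> 0) (at 0)"
      if "i < 2" "j < 2" for i j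
      unfolding U_def f_def c_def by (rule splitting_error_quotient_tendsto_0 [OF A B ord r that dim])
    \<comment> \<open>Determinant 1 turns \<open>4 - (p + q)\<^sup>2\<close> into
      \<open>- (p - q)\<^sup>2 - 4 * m * n\<close>, a quadratic form in entries of first order in
      \<open>h\<close>. Hence first-order limits determine the second-order behaviour of the squared
      trace, and no second-order expansion is called for.\<close>
    have quotient: "- ((f 0 0 h - 1) / h - (f 1 1 h - 1) / h)\<^sup>2 - 4 * (f 0 1 h / h) * (f 1 0 h / h)
        = (4 - (f 0 0 h + f 1 1 h)\<^sup>2) / (of_real h)\<^sup>2" for h :: real
    proof -
      have "f 0 0 h * f 1 1 h - f 0 1 h * f 1 0 h = 1"
        using dt [of h] by (subst (asm) U_mat2) (simp only: det_mat2 f_def)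
      moreover have "4 - (p + q)\<^sup>2 = - (p - q)\<^sup>2 - 4 * m * n" if "p * q - m * n = 1" for p q m n :: complex
      proof -
        have "p * q = 1 + m * n" using that by (simp add: algebra_simps)
        then have "4 * (p * q) = 4 + 4 * m * n" by simp
        then show ?thesis by (simp add: power2_eq_square algebra_simps)
      qed
      ultimately have "4 - (f 0 0 h + f 1 1 h)\<^sup>2 = - (f 0 0 h - f 1 1 h)\<^sup>2 - 4 * f 0 1 h * f 1 0 h"
        by blast
      then show ?thesis
        by (simp add: diff_divide_distrib [symmetric] power_divide) (simp add: power2_eq_square divide_inverse algebra_simps)
    qed
    note lim = pauli_exp_difference_quotient [OF False]
    \<comment> \<open>Subtracting the error quotients carries the limits over from the exact
      exponential to the method.\<close>
    have "((\<lambda>h :: real. (f 0 0 h - 1) / h) \<longlongrightarrow> - \<i> * c $ 2) (at 0)"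
      using tendsto_diff [OF lim(1) err [of 0 0]] by (simp add: diff_divide_distrib)
    moreover have "((\<lambda>h :: real. (f 1 1 h - 1) / h) \<longlongrightarrow> \<i> * c $ 2) (at 0)"
      using tendsto_diff [OF lim(4) err [of 1 1]] by (simp add: diff_divide_distrib)
    moreover have "((\<lambda>h :: real. f 0 1 h / h) \<longlongrightarrow> - \<i> * (c $ 0 - \<i> * c $ 1)) (at 0)"
      using tendsto_diff [OF lim(2) err [of 0 1]] by (simp add: diff_divide_distrib)
    moreover have "((\<lambda>h :: real. f 1 0 h / h) \<longlongrightarrow> - \<i> * (c $ 0 + \<i> * c $ 1)) (at 0)"
      using tendsto_diff [OF lim(3) err [of 1 0]] by (simp add: diff_divide_distrib)
    ultimately have "((\<lambda>h :: real. - ((f 0 0 h - 1) / h - (f 1 1 h - 1) / h)\<^sup>2 - 4 * (f 0 1 h / h) * (f 1 0 h / h)) \<longlongrightarrow>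
      - (- \<i> * c $ 2 - \<i> * c $ 2)\<^sup>2 - 4 * (- \<i> * (c $ 0 - \<i> * c $ 1)) * (- \<i> * (c $ 0 + \<i> * c $ 1))) (at 0)"
      by (intro tendsto_intros)
    also have "- (- \<i> * c $ 2 - \<i> * c $ 2)\<^sup>2 - 4 * (- \<i> * (c $ 0 - \<i> * c $ 1)) * (- \<i> * (c $ 0 + \<i> * c $ 1))
        = 4 * (of_real (norm3 c))\<^sup>2"
      unfolding of_real_norm3_sq by (simp add: power2_eq_square algebra_simps)
    \<comment> \<open>Passing to real parts allows a comparison with \<open>0\<close>; that the
      trace is real enters only afterwards.\<close>
    finally have "((\<lambda>h :: real. Re ((4 - (f 0 0 h + f 1 1 h)\<^sup>2) / (of_real h)\<^sup>2)) \<longlongrightarrow> Re (4 * (of_real (norm3 c))\<^sup>2)) (at 0)"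
      unfolding quotient by (rule tendsto_Re)
    moreover have "Re (4 * (of_real (norm3 c))\<^sup>2) > 0"
      using False by (simp flip: of_real_power)
    ultimately have "eventually (\<lambda>h :: real. Re ((4 - (f 0 0 h + f 1 1 h)\<^sup>2) / (of_real h)\<^sup>2) > 0) (at 0)"
      by (rule order_tendstoD)
    then obtain h' where h': "h' > 0"
      "\<And>h. h \<noteq> 0 \<Longrightarrow> \<bar>h\<bar> < h' \<Longrightarrow> Re ((4 - (f 0 0 h + f 1 1 h)\<^sup>2) / (of_real h)\<^sup>2) > 0"
      by (auto simp: eventually_at)
    show ?thesis
    proof (intro exI [of _ h'] conjI allI impI; (elim conjE)?)
      fix h :: real assume h: "0 < h" "h < h'"
      have "f 0 0 h + f 1 1 h \<in> \<real>"
        unfolding f_def by (rule trace_splitting_step_real [OF A B sc]) (use U_mat2 [of h] U_def in simp)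
      then obtain t where t: "f 0 0 h + f 1 1 h = of_real t" by (auto elim: Reals_cases)
      have "Re ((4 - (of_real t)\<^sup>2) / (of_real h)\<^sup>2) > 0"
        using h'(2) [of h, unfolded t] h by simp
      also have "(4 - (of_real t)\<^sup>2) / (of_real h)\<^sup>2 = complex_of_real ((4 - t\<^sup>2) / h\<^sup>2)"
        by simp
      finally have "t\<^sup>2 < 4" using h by (simp add: zero_less_divide_iff)
      then have "\<bar>t\<bar> < 2" using abs_square_less_1 [of "t / 2"] by (simp add: power_divide)
      note * = unitary_conjugate_if_trace_less_2 [OF U_mat2 dt t [unfolded f_def] this]
      show "cmod z = 1" if "eigenvalue (U h) z" for z
        using that by (rule *(1))
      show "\<exists>P \<in> carrier_mat 2 2. \<exists>Q \<in> carrier_mat 2 2.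
          inverts_mat P Q \<and> inverts_mat Q P \<and> unitary_mat (P * U h * Q)"
        by (rule *(2))
    qed (use h' in simp)
  qed
  then show ?thesis by (simp only: U_def)
qed

end
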